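(* Each of the algorithms \textsf{P}, \textsf{E}, \textsf{A}, \textsf{R}, \textsf{RA} (defined below) is correct: run on an undirected graph with vertex set $[n]$, when it stops, the parent pointers form exactly one flat tree per connected component of the input graph; that is, for every vertex $v$, $v.p$ is a vertex of the component of $v$ with $(v.p).p=v.p$, and two vertices have the same parent if and only if they lie in the same connected component.
   Context: Each edge $e$ has two ends $e.v,e.w$; the current edge set is initially the input edge set. Each vertex $v$ has a parent $v.p$, initially $v$; $v$ is a root if $v.p=v$. The algorithms keep the parent digraph acyclic apart from loops at roots, so it is a forest (the label forest) whose trees are rooted at roots; a tree is flat if every non-root vertex in it has the root as parent. Vertices are compared as integers. Each operation is performed simultaneously for all edges/vertices using values at the start of the operation. \textsc{connect}: for each edge $e$, send $\min\{e.v,e.w\}$ to $\max\{e.v,e.w\}$. \textsc{parent-connect}: for each edge $e$, let $x=e.v.p$, $y=e.w.p$; send $\min\{x,y\}$ to $\max\{x,y\}$. \textsc{extended-connect}: for each edge $e$, let $x=e.v.p$, $y=e.w.p$; if $y<x$ send $y$ to $e.v$ and to $x$, else send $x$ to $e.w$ and to $y$. \textsc{update}: for each vertex $v$, replace $v.p$ by the minimum of $v.p$ and the vertices sent to $v$ in the preceding connect operation. \textsc{root-update}: the same, but only for roots $v$. \textsc{shortcut}: for each vertex $v$, replace $v.p$ by $(v.p).p$. \textsc{alter}: for each edge $e$, let $x=e.v.p$, $y=e.w.p$; if $x=y$ delete $e$, else replace $e.v,e.w$ by $x,y$. Each algorithm repeats a round until a round in which no parent changes: \textsf{P}: \textsc{parent-connect};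 \textsc{update}; \textsc{shortcut}. \textsf{E}: \textsc{extended-connect}; \textsc{update}; \textsc{shortcut}. \textsf{A}: \textsc{connect}; \textsc{update}; \textsc{shortcut}; \textsc{alter}. \textsf{R}: \textsc{parent-connect}; \textsc{root-update}; \textsc{shortcut}. \textsf{RA}: \textsc{connect}; \textsc{root-update}; \textsc{shortcut}; \textsc{alter}. *)

theory Defs
  imports Main
begin

text \<open>
  An undirected multigraph is given by a vertex count, a set of edges and the two ends of each
  edge. Which end is called \<open>v\<close> and which \<open>w\<close> is arbitrary; loops and parallel edges are allowed
  (replacing edge ends by their parents may create parallel edges from a simple input graph).
\<close>

record 'e ugraph =
  vcount :: nat
  edges :: "'e set"
  end_v :: "'e \<Rightarrow> nat"
  end_w :: "'e \<Rightarrow> nat"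

definition vertices :: "('e, 'z) ugraph_scheme \<Rightarrow> nat set" where
  "vertices G = {1..vcount G}"

definition ugraph :: "('e, 'z) ugraph_scheme \<Rightarrow> bool" where
  "ugraph G \<longleftrightarrow> finite (edges G) \<and>
     (\<forall>e\<in>edges G. end_v G e \<in> vertices G \<and> end_w G e \<in> vertices G)"

definition adjacency :: "('e, 'z) ugraph_scheme \<Rightarrow> (nat \<times> nat) set" where
  "adjacency G =
     {(end_v G e, end_w G e) | e. e \<in> edges G} \<union> {(end_w G e, end_v G e) | e. e \<in> edges G}"

definition component :: "('e, 'z) ugraph_scheme \<Rightarrow> nat \<Rightarrow> nat set" where
  "component G v = {u \<in> vertices G. (v, u) \<in> (adjacency G)\<^sup>*}"

text \<open>A state is the current graph together with the parent pointers.\<close>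

record 'e state = "'e ugraph" +
  parent :: "nat \<Rightarrow> nat"

definition init :: "'e ugraph \<Rightarrow> 'e state" where
  "init G = \<lparr>vcount = vcount G, edges = edges G, end_v = end_v G, end_w = end_w G,
     parent = \<lambda>v. v\<rparr>"

text \<open>
  A connect operation yields the set of its messages; \<open>(a, u)\<close> means that \<open>a\<close> is sent to \<open>u\<close>.
\<close>

definition connect :: "'e state \<Rightarrow> (nat \<times> nat) set" where
  "connect s =
     {(min (end_v s e) (end_w s e), max (end_v s e) (end_w s e)) | e. e \<in> edges s}"

definition parent_connect :: "'e state \<Rightarrow> (nat \<times> nat) set" where
  "parent_connect s =
     {(min x y, max x y) | x y e.
        e \<in> edges s \<and> x = parent s (end_v s e) \<and> y = parent s (end_w s e)}"

definition extended_connect :: "'e state \<Rightarrow> (nat \<times> nat) set" where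
  "extended_connect s =
     (\<Union>e\<in>edges s.
        let x = parent s (end_v s e); y = parent s (end_w s e)
        in if y < x then {(y, end_v s e), (y, x)} else {(x, end_w s e), (x, y)})"

definition update :: "(nat \<times> nat) set \<Rightarrow> 'e state \<Rightarrow> 'e state" where
  "update M s = s\<lparr>parent := \<lambda>v. Min (insert (parent s v) {a. (a, v) \<in> M})\<rparr>"

definition root_update :: "(nat \<times> nat) set \<Rightarrow> 'e state \<Rightarrow> 'e state" where
  "root_update M s = s\<lparr>parent := \<lambda>v.
     if parent s v = v then Min (insert (parent s v) {a. (a, v) \<in> M}) else parent s v\<rparr>"

definition shortcut :: "'e state \<Rightarrow> 'e state" where
  "shortcut s = s\<lparr>parent := \<lambda>v. parent s (parent s v)\<rparr>"

definition alter :: "'e state \<Rightarrow> 'e state" where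
  "alter s = s\<lparr>
     edges := {e \<in> edges s. parent s (end_v s e) \<noteq> parent s (end_w s e)},
     end_v := \<lambda>e. parent s (end_v s e),
     end_w := \<lambda>e. parent s (end_w s e)\<rparr>"

datatype algorithm = Alg_P | Alg_E | Alg_A | Alg_R | Alg_RA

fun round :: "algorithm \<Rightarrow> 'e state \<Rightarrow> 'e state" where
  "round Alg_P s = shortcut (update (parent_connect s) s)"
| "round Alg_E s = shortcut (update (extended_connect s) s)"
| "round Alg_A s = alter (shortcut (update (connect s) s))"
| "round Alg_R s = shortcut (root_update (parent_connect s) s)"
| "round Alg_RA s = alter (shortcut (root_update (connect s) s))"

definition parent_unchanged :: "'e state \<Rightarrow> 'e state \<Rightarrow> bool" where
  "parent_unchanged s t \<longleftrightarrow> (\<forall>v\<in>vertices s. parent t v = parent s v)"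

text \<open>
  \<open>stops_in alg s t\<close>: the loop started in \<open>s\<close> stops, and it does so in state \<open>t\<close>. At least one
  round is performed, and the state after the round without a parent change is the final one.
\<close>

inductive stops_in :: "algorithm \<Rightarrow> 'e state \<Rightarrow> 'e state \<Rightarrow> bool" for alg where
  last: "parent_unchanged s (round alg s) \<Longrightarrow> stops_in alg s (round alg s)"
| again: "\<not> parent_unchanged s (round alg s) \<Longrightarrow> stops_in alg (round alg s) t
    \<Longrightarrow> stops_in alg s t"

end

theory Submission
  imports Defs
begin

text \<open>
  Current edges and parent pointers together generate an equivalence relation on the vertices,
  initially the relation of being in the same component, and every operation preserves it. An
  update that cuts a non-root from its old parent does no harm, since every end of a current edge is
  connected to its parent by current edges alone; alteration keeps this property, because it maps
  paths to paths.

  Parents never increase, so the sum of all parents is a termination measure. A round that changes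
  no parent starts from flat trees in which no root receives a smaller vertex. Then the two ends of
  an edge have the same parent: their parents are roots, and so are the ends themselves in the
  algorithms with alteration, where every end of an edge is a parent. Hence the parent is constant
  on the classes of the equivalence relation.
\<close>

section \<open>Adjacency and linkage\<close>

lemma sym_adjacency: "sym (adjacency G)"
  by (auto simp: sym_def adjacency_def)

lemma equiv_adjacency_rtrancl: "equiv UNIV ((adjacency G)\<^sup>*)"
  by (simp add: equiv_def refl_rtrancl sym_rtrancl sym_adjacency trans_rtrancl)

lemma adjacency_rtrancl_in_vertices:
  assumes "ugraph G" and "(u, v) \<in> (adjacency G)\<^sup>*" and "u \<noteq> v"
  shows "u \<in> vertices G" and "v \<in> vertices G"
proof -
  have edge: "a \<in> vertices G \<and> b \<in> vertices G" if "(a, b) \<in> adjacency G" for a b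
    using that \<open>ugraph G\<close> by (auto simp: adjacency_def ugraph_def)
  show "u \<in> vertices G"
    using assms(2,3) edge by (metis converse_rtranclE)
  show "v \<in> vertices G"
    using assms(2,3) edge by (metis rtranclE)
qed

lemma Domain_rtrancl_sym:
  assumes "sym r" and "(a, b) \<in> r\<^sup>*"
  shows "a \<in> Domain r \<longleftrightarrow> b \<in> Domain r"
  using assms(2)
proof (induction rule: rtrancl_induct)
  case (step b c)
  then show ?case using symD[OF \<open>sym r\<close>] by blast
qed simp

definition links :: "'e state \<Rightarrow> (nat \<times> nat) set" where
  "links s = adjacency s \<union> range (\<lambda>v. (v, parent s v)) \<union> range (\<lambda>v. (parent s v, v))"

definition linkage :: "'e state \<Rightarrow> (nat \<times> nat) set" where
  "linkage s = (links s)\<^sup>*"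

lemma equiv_linkage: "equiv UNIV (linkage s)"
proof -
  have "sym (links s)"
    using symD[OF sym_adjacency] by (auto simp: links_def intro!: symI)
  then show ?thesis
    by (simp add: linkage_def equiv_def refl_rtrancl sym_rtrancl trans_rtrancl)
qed

lemma linkage_refl: "(u, u) \<in> linkage s"
  and linkage_sym: "(u, v) \<in> linkage s \<Longrightarrow> (v, u) \<in> linkage s"
  and linkage_trans: "(u, v) \<in> linkage s \<Longrightarrow> (v, w) \<in> linkage s \<Longrightarrow> (u, w) \<in> linkage s"
  using equiv_linkage[of s] by (auto simp: equiv_def dest: refl_onD symD transD)

lemma parent_in_linkage: "(v, parent s v) \<in> linkage s"
  by (auto simp: linkage_def links_def)

lemma adjacency_rtrancl_subset_linkage: "(adjacency s)\<^sup>* \<subseteq> linkage s"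
  unfolding linkage_def links_def by (rule rtrancl_mono) blast

lemma linkage_least:
  assumes "equiv UNIV r" and "adjacency s \<subseteq> r" and "\<And>v. (v, parent s v) \<in> r"
  shows "linkage s \<subseteq> r"
proof -
  have "refl r" "sym r" "trans r"
    using assms(1) by (auto simp: equiv_def)
  have "links s \<subseteq> r"
    using assms(2,3) symD[OF \<open>sym r\<close>] by (auto simp: links_def)
  then have "linkage s \<subseteq> r\<^sup>*"
    unfolding linkage_def by (rule rtrancl_mono)
  also have "r\<^sup>* = r"
    using \<open>refl r\<close> \<open>trans r\<close> by (auto simp: rtrancl_trancl_reflcl refl_on_def)
  finally show ?thesis .
qed

lemma linkage_subsetI:
  assumes "\<And>a b. (a, b) \<in> adjacency s \<Longrightarrow> (a, b) \<in> linkage t"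
    and "\<And>v. (v, parent s v) \<in> linkage t"
  shows "linkage s \<subseteq> linkage t"
  using assms by (intro linkage_least equiv_linkage) auto

section \<open>Rounds as sequences of operations\<close>

fun messages :: "algorithm \<Rightarrow> 'e state \<Rightarrow> (nat \<times> nat) set" where
  "messages Alg_P s = parent_connect s"
| "messages Alg_E s = extended_connect s"
| "messages Alg_A s = connect s"
| "messages Alg_R s = parent_connect s"
| "messages Alg_RA s = connect s"

definition hook :: "algorithm \<Rightarrow> 'e state \<Rightarrow> 'e state" where
  "hook alg s =
     (if alg \<in> {Alg_R, Alg_RA} then root_update (messages alg s) s else update (messages alg s) s)"

definition alters :: "algorithm \<Rightarrow> bool" where
  "alters alg \<longleftrightarrow> alg \<in> {Alg_A, Alg_RA}"

lemma round_eq: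
  "round alg s = (if alters alg then alter (shortcut (hook alg s)) else shortcut (hook alg s))"
  by (cases alg) (simp_all add: hook_def alters_def)

lemma edges_hook [simp]: "edges (hook alg s) = edges s"
  and vertices_hook [simp]: "vertices (hook alg s) = vertices s"
  and adjacency_hook [simp]: "adjacency (hook alg s) = adjacency s"
  by (simp_all add: hook_def update_def root_update_def vertices_def adjacency_def)

lemma edges_shortcut [simp]: "edges (shortcut s) = edges s"
  and vertices_shortcut [simp]: "vertices (shortcut s) = vertices s"
  and adjacency_shortcut [simp]: "adjacency (shortcut s) = adjacency s"
  and parent_shortcut [simp]: "parent (shortcut s) v = parent s (parent s v)"
  by (simp_all add: shortcut_def vertices_def adjacency_def)

lemma finite_edges_alter [simp]: "finite (edges s) \<Longrightarrow> finite (edges (alter s))"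
  and vertices_alter [simp]: "vertices (alter s) = vertices s"
  and parent_alter [simp]: "parent (alter s) = parent s"
  by (simp_all add: alter_def vertices_def)

lemma adjacency_alter:
  "adjacency (alter s) =
     {(parent s a, parent s b) | a b. (a, b) \<in> adjacency s \<and> parent s a \<noteq> parent s b}"
  by (fastforce simp: adjacency_def alter_def)

lemma vertices_round: "vertices (round alg s) = vertices s"
  by (simp add: round_eq)

lemma parent_round: "parent (round alg s) v = parent (hook alg s) (parent (hook alg s) v)"
  by (simp add: round_eq)

lemma finite_messages:
  assumes "finite (edges s)"
  shows "finite (messages alg s)"
proof -
  have "connect s = (\<lambda>e. (min (end_v s e) (end_w s e), max (end_v s e) (end_w s e))) ` edges s"
    by (auto simp: connect_def)
  moreover have "parent_connect s = (\<lambda>e. let x = parent s (end_v s e); y = parent s (end_w s e)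
       in (min x y, max x y)) ` edges s"
    by (auto simp: parent_connect_def Let_def)
  moreover have "finite (extended_connect s)"
    using assms by (auto simp: extended_connect_def Let_def)
  ultimately show ?thesis using assms by (cases alg) simp_all
qed

lemma Min_insert_senders:
  assumes "finite M"
  shows "Min (insert x {a. (a, v) \<in> M}) \<le> x"
    and "(a, v) \<in> M \<Longrightarrow> Min (insert x {a. (a, v) \<in> M}) \<le> a"
    and "Min (insert x {a. (a, v) \<in> M}) = x \<or> (Min (insert x {a. (a, v) \<in> M}), v) \<in> M"
proof -
  let ?A = "insert x {a. (a, v) \<in> M}"
  have "{a. (a, v) \<in> M} \<subseteq> Domain M" by blast
  then have "finite ?A"
    using assms finite_Domain finite_subset by blast
  then show "Min ?A \<le> x" "(a, v) \<in> M \<Longrightarrow> Min ?A \<le> a" "Min ?A = x \<or> (Min ?A, v) \<in> M"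
    using Min_le[of ?A] Min_in[of ?A] by blast+
qed

lemma parent_hook:
  "parent (hook alg s) v =
     (if alg \<in> {Alg_R, Alg_RA} \<and> parent s v \<noteq> v then parent s v
      else Min (insert (parent s v) {a. (a, v) \<in> messages alg s}))"
  by (simp add: hook_def update_def root_update_def)

lemma
  assumes "finite (edges s)"
  shows parent_hook_le: "parent (hook alg s) v \<le> parent s v"
    and parent_hook_le_sender:
      "parent s v = v \<Longrightarrow> (a, v) \<in> messages alg s \<Longrightarrow> parent (hook alg s) v \<le> a"
    and parent_hook_cases:
      "parent (hook alg s) v = parent s v \<or> (parent (hook alg s) v, v) \<in> messages alg s"
  using Min_insert_senders[OF finite_messages[OF assms, of alg]]
  by (metis parent_hook order_refl)+

section \<open>Coherent states\<close>

definition coherent :: "'e state \<Rightarrow> bool" where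
  "coherent s \<longleftrightarrow> finite (edges s) \<and> (\<forall>v. parent s v \<le> v) \<and>
     (\<forall>v\<in>Domain (adjacency s). (v, parent s v) \<in> (adjacency s)\<^sup>*)"

lemma coherentD:
  assumes "coherent s"
  shows "finite (edges s)" and "parent s v \<le> v"
    and "v \<in> Domain (adjacency s) \<Longrightarrow> (v, parent s v) \<in> (adjacency s)\<^sup>*"
  using assms by (auto simp: coherent_def)

lemma messages_subset_adjacency_rtrancl:
  assumes "coherent s"
  shows "messages alg s \<subseteq> (adjacency s)\<^sup>*"
proof clarify
  fix a b assume "(a, b) \<in> messages alg s"
  then obtain e where "e \<in> edges s" and e: "(a, b) \<in>
      (let x = end_v s e; y = end_w s e; x' = parent s x; y' = parent s y
       in {(x, y), (y, x), (x', y'), (y', x'), (x', y), (y', x)})"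
    by (cases alg)
      (auto simp: connect_def parent_connect_def extended_connect_def Let_def min_def max_def
        split: if_splits)
  have edge: "(end_v s e, end_w s e) \<in> adjacency s" "(end_w s e, end_v s e) \<in> adjacency s"
    using \<open>e \<in> edges s\<close> by (auto simp: adjacency_def)
  then have "(end_v s e, parent s (end_v s e)) \<in> (adjacency s)\<^sup>*"
    "(end_w s e, parent s (end_w s e)) \<in> (adjacency s)\<^sup>*"
    using coherentD(3)[OF assms] by blast+
  then have "\<forall>x\<in>{end_w s e, parent s (end_v s e), parent s (end_w s e)}.
      (end_v s e, x) \<in> (adjacency s)\<^sup>*"
    using edge(1) by (auto intro: converse_rtrancl_into_rtrancl)
  moreover have "(x, y) \<in> (adjacency s)\<^sup>*"
    if "(end_v s e, x) \<in> (adjacency s)\<^sup>*" "(end_v s e, y) \<in> (adjacency s)\<^sup>*" for x y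
    using that symD[OF sym_rtrancl[OF sym_adjacency]] by (meson rtrancl_trans)
  ultimately show "(a, b) \<in> (adjacency s)\<^sup>*"
    using e by (auto simp: Let_def)
qed

lemma parent_hook_cases_adjacency:
  assumes "coherent s"
  shows "parent (hook alg s) v = parent s v \<or> (v, parent (hook alg s) v) \<in> (adjacency s)\<^sup>*"
  using parent_hook_cases[OF coherentD(1)[OF assms]] messages_subset_adjacency_rtrancl[OF assms]
    symD[OF sym_rtrancl[OF sym_adjacency]] by blast

lemma coherent_hook:
  assumes "coherent s"
  shows "coherent (hook alg s)"
proof -
  have "parent (hook alg s) v \<le> v" for v
    using parent_hook_le[OF coherentD(1)] coherentD(2) assms by (metis order_trans)
  moreover have "(v, parent (hook alg s) v) \<in> (adjacency s)\<^sup>*" if "v \<in> Domain (adjacency s)" for v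
    using parent_hook_cases_adjacency[OF assms] coherentD(3)[OF assms that] by metis
  ultimately show ?thesis using coherentD(1)[OF assms] by (simp add: coherent_def)
qed

lemma linkage_hook:
  assumes "coherent s"
  shows "linkage (hook alg s) = linkage s"
proof
  show "linkage (hook alg s) \<subseteq> linkage s"
  proof (rule linkage_subsetI)
    show "(v, parent (hook alg s) v) \<in> linkage s" for v
      using parent_hook_cases_adjacency[OF assms, of alg v] parent_in_linkage[of v s]
        adjacency_rtrancl_subset_linkage by auto
  qed (use adjacency_rtrancl_subset_linkage in auto)
next
  have paths: "(adjacency s)\<^sup>* \<subseteq> linkage (hook alg s)"
    using adjacency_rtrancl_subset_linkage[of "hook alg s"] by simp
  show "linkage s \<subseteq> linkage (hook alg s)"
  proof (rule linkage_subsetI)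
    fix v
    show "(v, parent s v) \<in> linkage (hook alg s)"
    proof (cases "v \<in> Domain (adjacency s)")
      case True
      then show ?thesis using coherentD(3)[OF assms] paths by blast
    next
      case False
      then have "parent (hook alg s) v = parent s v \<or> parent (hook alg s) v = v"
        using parent_hook_cases_adjacency[OF assms] by (metis Not_Domain_rtrancl)
      then have "parent (hook alg s) v = parent s v"
        using parent_hook_le[OF coherentD(1)[OF assms], of alg v] coherentD(2)[OF assms, of v]
        by linarith
      then show ?thesis using parent_in_linkage[of v "hook alg s"] by simp
    qed
  qed (use paths in auto)
qed

lemma coherent_shortcut:
  assumes "coherent s"
  shows "coherent (shortcut s)"
proof -
  have "parent s (parent s v) \<le> v" for v
    using coherentD(2)[OF assms] order_trans by blast
  moreover have "(v, parent s (parent s v)) \<in> (adjacency s)\<^sup>*" if "v \<in> Domain (adjacency s)" for v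
  proof -
    have "(v, parent s v) \<in> (adjacency s)\<^sup>*"
      using coherentD(3)[OF assms that] .
    moreover from this have "parent s v \<in> Domain (adjacency s)"
      using that Domain_rtrancl_sym[OF sym_adjacency] by blast
    ultimately show ?thesis
      using coherentD(3)[OF assms] by (meson rtrancl_trans)
  qed
  ultimately show ?thesis using coherentD(1)[OF assms] by (simp add: coherent_def)
qed

lemma linkage_shortcut:
  assumes "coherent s"
  shows "linkage (shortcut s) = linkage s"
proof
  show "linkage (shortcut s) \<subseteq> linkage s"
  proof (rule linkage_subsetI)
    show "(v, parent (shortcut s) v) \<in> linkage s" for v
      using linkage_trans[OF parent_in_linkage parent_in_linkage] by simp
  qed (use adjacency_rtrancl_subset_linkage in auto)
next
  have paths: "(adjacency s)\<^sup>* \<subseteq> linkage (shortcut s)"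
    using adjacency_rtrancl_subset_linkage[of "shortcut s"] by simp
  show "linkage s \<subseteq> linkage (shortcut s)"
  proof (rule linkage_subsetI)
    fix v
    show "(v, parent s v) \<in> linkage (shortcut s)"
    proof (induction v rule: less_induct)
      case (less v)
      have "(parent s v, parent s (parent s v)) \<in> linkage (shortcut s)"
        if "parent s v \<noteq> v"
        using less.IH that coherentD(2)[OF assms, of v] by simp
      then show ?case
        using parent_in_linkage[of v "shortcut s"] linkage_refl linkage_sym linkage_trans
        by (metis parent_shortcut)
    qed
  qed (use paths in auto)
qed

lemma coherent_alter:
  assumes "coherent s"
  shows "coherent (alter s)"
proof -
  have path: "(parent s a, parent s b) \<in> (adjacency (alter s))\<^sup>*"
    if "(a, b) \<in> (adjacency s)\<^sup>*" for a b
    using that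
  proof (induction rule: rtrancl_induct)
    case (step b c)
    then have "parent s b = parent s c \<or> (parent s b, parent s c) \<in> adjacency (alter s)"
      unfolding adjacency_alter by blast
    then show ?case using step.IH by auto
  qed simp
  have "(v, parent s v) \<in> (adjacency (alter s))\<^sup>*" if "v \<in> Domain (adjacency (alter s))" for v
  proof -
    obtain a where "v = parent s a" and "a \<in> Domain (adjacency s)"
      using \<open>v \<in> Domain (adjacency (alter s))\<close> by (auto simp: adjacency_alter)
    then show ?thesis using path coherentD(3)[OF assms] by blast
  qed
  then show ?thesis using assms by (simp add: coherent_def)
qed

lemma linkage_alter: "linkage (alter s) = linkage s"
proof
  show "linkage (alter s) \<subseteq> linkage s"
  proof (rule linkage_subsetI)
    fix a b assume "(a, b) \<in> adjacency (alter s)"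
    then obtain a' b' where "a = parent s a'" "b = parent s b'" "(a', b') \<in> adjacency s"
      by (auto simp: adjacency_alter)
    then show "(a, b) \<in> linkage s"
      using parent_in_linkage adjacency_rtrancl_subset_linkage
      by (meson linkage_sym linkage_trans r_into_rtrancl subsetD)
  qed (simp add: parent_in_linkage)
next
  show "linkage s \<subseteq> linkage (alter s)"
  proof (rule linkage_subsetI)
    fix a b assume "(a, b) \<in> adjacency s"
    then have "parent s a = parent s b \<or> (parent s a, parent s b) \<in> adjacency (alter s)"
      by (auto simp: adjacency_alter)
    then have "(parent s a, parent s b) \<in> linkage (alter s)"
      using adjacency_rtrancl_subset_linkage linkage_refl by (metis r_into_rtrancl subsetD)
    then show "(a, b) \<in> linkage (alter s)"
      using parent_in_linkage[of _ "alter s"] by (metis linkage_sym linkage_trans parent_alter)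
  next
    show "(v, parent s v) \<in> linkage (alter s)" for v
      using parent_in_linkage[of v "alter s"] by simp
  qed
qed

lemma coherent_round: "coherent s \<Longrightarrow> coherent (round alg s)"
  by (simp add: round_eq coherent_hook coherent_shortcut coherent_alter)

lemma linkage_round: "coherent s \<Longrightarrow> linkage (round alg s) = linkage s"
  by (simp add: round_eq linkage_hook linkage_shortcut linkage_alter coherent_hook)

definition edge_ends_are_parents :: "algorithm \<Rightarrow> 'e state \<Rightarrow> bool" where
  "edge_ends_are_parents alg s \<longleftrightarrow>
     (alters alg \<longrightarrow> Domain (adjacency s) \<subseteq> range (parent s))"

lemma edge_ends_are_parents_round: "edge_ends_are_parents alg (round alg s)"
  by (auto simp: edge_ends_are_parents_def round_eq adjacency_alter)

lemma parent_round_le_hook: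
  assumes "coherent s"
  shows "parent (round alg s) v \<le> parent (hook alg s) v"
  using coherentD(2)[OF coherent_hook[OF assms]] by (simp add: parent_round)

lemma parent_round_le:
  assumes "coherent s"
  shows "parent (round alg s) v \<le> parent s v"
  using parent_round_le_hook[OF assms] parent_hook_le[OF coherentD(1)[OF assms]]
  by (rule order_trans)

section \<open>Termination and partial correctness\<close>

lemma stops_in_exists: "coherent s \<Longrightarrow> \<exists>t. stops_in alg s t"
proof (induction "\<Sum>v\<in>vertices s. parent s v" arbitrary: s rule: less_induct)
  case less
  show ?case
  proof (cases "parent_unchanged s (round alg s)")
    case True
    then show ?thesis by (blast intro: stops_in.last)
  next
    case False
    have le: "parent (round alg s) v \<le> parent s v" for v
      using less.prems by (rule parent_round_le)
    have "\<exists>v\<in>vertices s. parent (round alg s) v < parent s v"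
      using False le unfolding parent_unchanged_def by (metis le_neq_implies_less)
    then have "(\<Sum>v\<in>vertices s. parent (round alg s) v) < (\<Sum>v\<in>vertices s. parent s v)"
      using le by (intro sum_strict_mono_ex1) (auto simp: vertices_def)
    then have "\<exists>t. stops_in alg (round alg s) t"
      using less.hyps coherent_round[OF less.prems] by (simp add: vertices_round)
    then show ?thesis using False by (blast intro: stops_in.again)
  qed
qed

lemma stops_in_last_round:
  assumes "stops_in alg s t" and "I s" and "\<And>s. I s \<Longrightarrow> I (round alg s)"
  obtains r where "I r" and "t = round alg r" and "parent_unchanged r (round alg r)"
  using assms by (induction arbitrary: thesis rule: stops_in.induct) blast+

definition loop_invariant :: "algorithm \<Rightarrow> 'e ugraph \<Rightarrow> 'e state \<Rightarrow> bool" where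
  "loop_invariant alg G s \<longleftrightarrow> coherent s \<and> vertices s = vertices G \<and>
     linkage s = (adjacency G)\<^sup>* \<and> edge_ends_are_parents alg s"

lemma init_simps:
  "edges (init G) = edges G" "vertices (init G) = vertices G"
  "adjacency (init G) = adjacency G" "parent (init G) = (\<lambda>v. v)"
  by (simp_all add: init_def vertices_def adjacency_def)

lemma coherent_init: "ugraph G \<Longrightarrow> coherent (init G)"
  by (simp add: coherent_def init_simps ugraph_def)

lemma linkage_init: "linkage (init G) = (adjacency G)\<^sup>*"
proof
  show "linkage (init G) \<subseteq> (adjacency G)\<^sup>*"
    by (rule linkage_least[OF equiv_adjacency_rtrancl]) (auto simp: init_simps)
  show "(adjacency G)\<^sup>* \<subseteq> linkage (init G)"
    using adjacency_rtrancl_subset_linkage[of "init G"] by (simp add: init_simps)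
qed

lemma loop_invariant_init: "ugraph G \<Longrightarrow> loop_invariant alg G (init G)"
  by (simp add: loop_invariant_def coherent_init linkage_init)
    (simp add: edge_ends_are_parents_def init_simps)

lemma loop_invariant_round: "loop_invariant alg G s \<Longrightarrow> loop_invariant alg G (round alg s)"
  by (simp add: loop_invariant_def coherent_round linkage_round vertices_round
      edge_ends_are_parents_round)

lemma parent_round_eq_if_unchanged:
  assumes "ugraph G" and "loop_invariant alg G s" and "parent_unchanged s (round alg s)"
  shows "parent (round alg s) = parent s"
proof
  fix v
  show "parent (round alg s) v = parent s v"
  proof (cases "v \<in> vertices G")
    case True
    then show ?thesis using assms(2,3) by (simp add: loop_invariant_def parent_unchanged_def)
  next
    case False
    have "parent t v = v" if "loop_invariant alg G t" for t
      using that parent_in_linkage[of v t] adjacency_rtrancl_in_vertices(1)[OF \<open>ugraph G\<close>] False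
      unfolding loop_invariant_def by metis
    then show ?thesis using assms(2) loop_invariant_round by metis
  qed
qed

definition stationary :: "algorithm \<Rightarrow> 'e state \<Rightarrow> bool" where
  "stationary alg s \<longleftrightarrow> coherent s \<and> parent (round alg s) = parent s"

lemma parent_hook_stationary:
  assumes "stationary alg s"
  shows "parent (hook alg s) = parent s"
proof
  fix v
  have "coherent s" and "parent (round alg s) v = parent s v"
    using assms by (simp_all add: stationary_def)
  then show "parent (hook alg s) v = parent s v"
    using parent_round_le_hook[of s alg v] parent_hook_le[OF coherentD(1), of s alg v]
    by simp
qed

lemma parent_parent_stationary:
  assumes "stationary alg s"
  shows "parent s (parent s v) = parent s v"
  using assms parent_hook_stationary[OF assms] by (metis parent_round stationary_def)

lemma sender_ge_root_stationary:
  assumes "stationary alg s" and "parent s v = v" and "(a, v) \<in> messages alg s"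
  shows "v \<le> a"
  using assms parent_hook_le_sender[of s v a alg] parent_hook_stationary[OF assms(1)]
  by (simp add: stationary_def coherent_def)

lemma parents_in_messages:
  assumes "(a, b) \<in> adjacency s" and "parent s a < parent s b"
    and "alters alg \<Longrightarrow> parent s a = a \<and> parent s b = b"
  shows "(parent s a, parent s b) \<in> messages alg s"
proof -
  obtain e where e: "e \<in> edges s"
    and ends: "(a, b) = (end_v s e, end_w s e) \<or> (a, b) = (end_w s e, end_v s e)"
    using assms(1) by (auto simp: adjacency_def)
  have "(parent s a, parent s b) =
      (min (parent s (end_v s e)) (parent s (end_w s e)),
       max (parent s (end_v s e)) (parent s (end_w s e)))"
    using ends assms(2) by auto
  then have "(parent s a, parent s b) \<in> parent_connect s"
    unfolding parent_connect_def using e by blast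
  moreover have "(parent s a, parent s b) \<in> extended_connect s"
    unfolding extended_connect_def using e ends assms(2)
    by (intro UN_I[of e]) (auto simp: Let_def)
  moreover have "(parent s a, parent s b) \<in> connect s" if "alters alg"
  proof -
    have "(a, b) = (min (end_v s e) (end_w s e), max (end_v s e) (end_w s e))"
      using ends assms(2) assms(3)[OF that] by auto
    then show ?thesis
      unfolding connect_def using e assms(3)[OF that] by auto
  qed
  ultimately show ?thesis by (cases alg) (simp_all add: alters_def)
qed

lemma parent_eq_if_adjacent_stationary:
  assumes "stationary alg s" and "edge_ends_are_parents alg s"
    and "(a, b) \<in> adjacency s"
  shows "parent s a = parent s b"
proof -
  have root: "parent s x = x" if "alters alg" "x \<in> Domain (adjacency s)" for x
    using assms(2) that parent_parent_stationary[OF assms(1)]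
    by (auto simp: edge_ends_are_parents_def)
  have "\<not> parent s x < parent s y" if "(x, y) \<in> adjacency s" for x y
  proof
    assume less: "parent s x < parent s y"
    have "x \<in> Domain (adjacency s)" "y \<in> Domain (adjacency s)"
      using that symD[OF sym_adjacency] by blast+
    then have "(parent s x, parent s y) \<in> messages alg s"
      using parents_in_messages[OF that less] root by blast
    then show False
      using sender_ge_root_stationary[OF assms(1)] parent_parent_stationary[OF assms(1)] less
      by (metis not_less)
  qed
  then show ?thesis
    using assms(3) symD[OF sym_adjacency] by (metis linorder_neqE)
qed

lemma parent_eq_iff_linkage:
  assumes "stationary alg s" and "edge_ends_are_parents alg s"
  shows "parent s u = parent s v \<longleftrightarrow> (u, v) \<in> linkage s"
proof
  assume "parent s u = parent s v"
  then show "(u, v) \<in> linkage s"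
    using parent_in_linkage by (metis linkage_sym linkage_trans)
next
  have "linkage s \<subseteq> {(x, y). parent s x = parent s y}"
  proof (rule linkage_least)
    show "equiv UNIV {(x, y). parent s x = parent s y}"
      by (auto simp: equiv_def refl_on_def sym_def trans_def)
    show "adjacency s \<subseteq> {(x, y). parent s x = parent s y}"
      using parent_eq_if_adjacent_stationary[OF assms] by blast
  qed (simp add: parent_parent_stationary[OF assms(1)])
  then show "parent s u = parent s v" if "(u, v) \<in> linkage s"
    using that by blast
qed

theorem theorem4:
  fixes G :: "'e ugraph" and alg :: algorithm
  assumes "ugraph G"
  shows "(\<exists>t. stops_in alg (init G) t) \<and>
    (\<forall>t. stops_in alg (init G) t \<longrightarrow>
      (\<forall>v\<in>vertices G. parent t v \<in> component G v \<and> parent t (parent t v) = parent t v) \<and>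
      (\<forall>u\<in>vertices G. \<forall>v\<in>vertices G.
         parent t u = parent t v \<longleftrightarrow> u \<in> component G v))"
proof (intro conjI allI impI)
  show "\<exists>t. stops_in alg (init G) t"
    using stops_in_exists[OF coherent_init[OF assms]] .
next
  fix t assume "stops_in alg (init G) t"
  then obtain r where inv: "loop_invariant alg G r" and t: "t = round alg r"
    and unchanged: "parent_unchanged r (round alg r)"
    by (rule stops_in_last_round[OF _ loop_invariant_init[OF assms] loop_invariant_round])
  have parent_t: "parent t = parent r"
    using parent_round_eq_if_unchanged[OF assms inv unchanged] by (simp add: t)
  then have "stationary alg r" using inv by (simp add: stationary_def loop_invariant_def t)
  have linkage: "linkage r = (adjacency G)\<^sup>*" using inv by (simp add: loop_invariant_def)
  show "\<forall>v\<in>vertices G. parent t v \<in> component G v \<and> parent t (parent t v) = parent t v"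
    using parent_in_linkage[of _ r] adjacency_rtrancl_in_vertices(2)[OF assms]
      parent_parent_stationary[OF \<open>stationary alg r\<close>]
    unfolding component_def linkage parent_t by (metis (mono_tags, lifting) mem_Collect_eq)
  have "parent t u = parent t v \<longleftrightarrow> (v, u) \<in> (adjacency G)\<^sup>*" for u v
    using parent_eq_iff_linkage[OF \<open>stationary alg r\<close>, of v u] inv
    by (auto simp: parent_t linkage loop_invariant_def)
  then show "\<forall>u\<in>vertices G. \<forall>v\<in>vertices G. parent t u = parent t v \<longleftrightarrow> u \<in> component G v"
    by (simp add: component_def)
qed

end
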